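(* Let $\Sigma_{SE(2)}$ be the linear control system on $SE(2)$ $$\dot g=\mathcal{X}(g)+u\,Y^L(g),\qquad g=(t,v)\in SE(2),\ u\in\Omega=[u^-,u^+],\ u^-<0<u^+,$$ with linear vector field $\mathcal{X}=(\xi,A)$, i.e. $\mathcal{X}(t,v)=(0,Av+\Lambda_t\xi)$, and left-invariant vector field $Y^L(t,v)=(\alpha,\rho_t\eta_1)$, $(\alpha,\eta_1)\in\mathbb{R}\times\mathbb{R}^2$. Assume that $\det A\neq 0$. Then there exists $\eta\in\mathbb{R}^2$ such that $\Sigma_{SE(2)}$ is equivalent to the control-affine system on $S^1\times\mathbb{R}^2$ $$\dot t=u\alpha,\qquad \dot v=(A-u\alpha\theta)v+u\eta,\qquad u\in\Omega .$$
   Context: $S^1=\mathbb{R}/2\pi\mathbb{Z}$; $\theta=\begin{pmatrix}0&-1\\1&0\end{pmatrix}$; $\rho_t=e^{t\theta}$ is the counter-clockwise rotation of $\mathbb{R}^2$ by angle $t$. $SE(2)$ is the Lie group with underlying manifold $S^1\times\mathbb{R}^2$ and product $(t_1,v_1)*(t_2,v_2)=(t_1+t_2,\,v_1+\rho_{t_1}v_2)$. A linear vector field on $SE(2)$ is a vector field of the form $\mathcal{X}(t,v)=(0,Av+\Lambda_t\xi)$, where $\xi\in\mathbb{R}^2$, $A$ is a real $2\times 2$ matrix with $A\theta=\theta A$, and $\Lambda_t\xi:=(I-\rho_t)\theta\xi$; it is denoted $\mathcal{X}=(\xi,A)$. A left-invariant vector field on $SE(2)$ has the form $Y^L(t,v)=(\alpha,\rho_t\eta_1)$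 with $(\alpha,\eta_1)\in\mathbb{R}\times\mathbb{R}^2$. Two control-affine systems $\dot x=f_0(x)+\sum_{j=1}^m u_jf_j(x)$ on $M$ and $\dot y=g_0(y)+\sum_{j=1}^m u_jg_j(y)$ on $N$, with the same control range, are equivalent if there is a diffeomorphism $\psi:M\to N$ with $d\psi\circ f_j=g_j\circ\psi$ for $j=0,1,\dots,m$. *)

theory Defs
  imports "HOL-Analysis.Analysis"
begin

section \<open>Smooth maps between Euclidean spaces\<close>

text \<open>All iterated directional derivatives up to order \<open>k\<close> exist on \<open>S\<close>; those of order \<open>k\<close> are
  continuous. For open \<open>S\<close> this is the class of \<open>k\<close> times continuously differentiable maps.\<close>

fun Ck_on :: "nat \<Rightarrow> ('a::euclidean_space \<Rightarrow> 'b::euclidean_space) \<Rightarrow> 'a set \<Rightarrow> bool" where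
  "Ck_on 0 f S \<longleftrightarrow> continuous_on S f"
| "Ck_on (Suc k) f S \<longleftrightarrow>
     (\<forall>x\<in>S. f differentiable (at x)) \<and> (\<forall>v. Ck_on k (\<lambda>x. frechet_derivative f (at x) v) S)"

definition smooth_on :: "('a::euclidean_space \<Rightarrow> 'b::euclidean_space) \<Rightarrow> 'a set \<Rightarrow> bool" where
  "smooth_on f S \<longleftrightarrow> (\<forall>k. Ck_on k f S)"


section \<open>The manifold \<open>S\<^sup>1 \<times> \<real>\<^sup>2\<close>\<close>

definition angle_eq :: "real \<Rightarrow> real \<Rightarrow> bool" where
  "angle_eq s t \<longleftrightarrow> (\<exists>k::int. t = s + 2 * pi * of_int k)"

lemma equivp_angle_eq: "equivp angle_eq"
proof (rule equivpI)
  show "reflp angle_eq"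
    by (rule reflpI) (auto simp: angle_eq_def intro!: exI[of _ 0])
  show "symp angle_eq"
  proof (rule sympI)
    fix s t assume "angle_eq s t"
    then obtain k :: int where "t = s + 2 * pi * of_int k" by (auto simp: angle_eq_def)
    then show "angle_eq t s" by (auto simp: angle_eq_def intro!: exI[of _ "-k"])
  qed
  show "transp angle_eq"
  proof (rule transpI)
    fix s t u assume "angle_eq s t" "angle_eq t u"
    then obtain k l :: int where "t = s + 2 * pi * of_int k" "u = t + 2 * pi * of_int l"
      by (auto simp: angle_eq_def)
    then show "angle_eq s u"
      by (auto simp: angle_eq_def algebra_simps intro!: exI[of _ "k + l"])
  qed
qed

quotient_type circle = real / angle_eq
  by (rule equivp_angle_eq)

type_synonym plane = "real ^ 2"
type_synonym cylinder = "circle \<times> plane"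

text \<open>The universal covering \<open>\<real> \<times> \<real>\<^sup>2 \<rightarrow> S\<^sup>1 \<times> \<real>\<^sup>2\<close>. Its local inverses are the charts of the
  quotient manifold, so the coordinate expressions of a map \<open>\<psi>\<close> of \<open>S\<^sup>1 \<times> \<real>\<^sup>2\<close> are the local lifts
  of \<open>\<psi>\<close> through this covering.\<close>

definition cover :: "real \<times> plane \<Rightarrow> cylinder" where
  "cover = map_prod abs_circle id"

definition local_lift ::
  "(cylinder \<Rightarrow> cylinder) \<Rightarrow> (real \<times> plane) set \<Rightarrow> (real \<times> plane \<Rightarrow> real \<times> plane) \<Rightarrow> bool" where
  "local_lift \<psi> W F \<longleftrightarrow> open W \<and> smooth_on F W \<and> (\<forall>q\<in>W. cover (F q) = \<psi> (cover q))"

definition smooth_map :: "(cylinder \<Rightarrow> cylinder) \<Rightarrow> bool" where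
  "smooth_map \<psi> \<longleftrightarrow> (\<forall>p. \<exists>W F. p \<in> W \<and> local_lift \<psi> W F)"

definition diffeomorphism :: "(cylinder \<Rightarrow> cylinder) \<Rightarrow> bool" where
  "diffeomorphism \<psi> \<longleftrightarrow> bij \<psi> \<and> smooth_map \<psi> \<and> smooth_map (inv \<psi>)"

text \<open>The covering trivialises the tangent bundle: every tangent space is identified with
  \<open>\<real> \<times> \<real>\<^sup>2\<close> by means of the coordinate fields \<open>\<partial>/\<partial>t\<close>, \<open>\<partial>/\<partial>v\<^sub>1\<close>, \<open>\<partial>/\<partial>v\<^sub>2\<close>, which are invariant under
  \<open>t \<mapsto> t + 2\<pi>\<close>. Vector fields and differentials are written in this frame.\<close>

type_synonym vector_field = "cylinder \<Rightarrow> real \<times> plane"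

definition has_differential ::
  "(cylinder \<Rightarrow> cylinder) \<Rightarrow> cylinder \<Rightarrow> (real \<times> plane \<Rightarrow> real \<times> plane) \<Rightarrow> bool" where
  "has_differential \<psi> x L \<longleftrightarrow>
     (\<exists>p W F. cover p = x \<and> p \<in> W \<and> local_lift \<psi> W F \<and> (F has_derivative L) (at p))"

text \<open>The identity \<open>d\<psi> \<circ> f = g \<circ> \<psi>\<close>.\<close>

definition related :: "(cylinder \<Rightarrow> cylinder) \<Rightarrow> vector_field \<Rightarrow> vector_field \<Rightarrow> bool" where
  "related \<psi> f g \<longleftrightarrow> (\<forall>x. \<exists>L. has_differential \<psi> x L \<and> L (f x) = g (\<psi> x))"

lemma abs_circle_eq_iff: "abs_circle s = abs_circle t \<longleftrightarrow> (\<exists>k::int. t = s + 2 * pi * of_int k)"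
  by (simp add: circle.abs_eq_iff angle_eq_def)

lemma abs_circle_surj: "\<exists>t. x = abs_circle t"
  by (induction x rule: circle.abs_induct) blast

lemma cover_eq_iff:
  "cover p = cover q \<longleftrightarrow> (\<exists>k::int. q = p + (2 * pi * of_int k, 0))"
  by (cases p; cases q) (auto simp: cover_def abs_circle_eq_iff)

text \<open>The differential does not depend on the chosen lifts.\<close>

lemma has_differential_unique:
  assumes "has_differential \<psi> x L" "has_differential \<psi> x L'"
  shows "L = L'"
proof -
  obtain p W F where F: "cover p = x" "p \<in> W" "local_lift \<psi> W F" "(F has_derivative L) (at p)"
    using assms(1) by (auto simp: has_differential_def)
  obtain q V G where G: "cover q = x" "q \<in> V" "local_lift \<psi> V G" "(G has_derivative L') (at q)"
    using assms(2) by (auto simp: has_differential_def)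
  have "cover p = cover q" using F(1) G(1) by simp
  then obtain k :: int where k: "q = p + (2 * pi * of_int k, 0)"
    by (auto simp: cover_eq_iff)
  define c :: "real \<times> plane" where "c = (2 * pi * of_int k, 0)"
  have cc: "cover (z + c) = cover z" for z
    using cover_eq_iff[of z "z + c"] by (auto simp: c_def)
  have q: "q = p + c" using k by (simp add: c_def)
  define H where "H = (\<lambda>z. G (z + c))"
  have H: "(H has_derivative L') (at p)"
  proof -
    have "(G has_derivative L') (at (p + c))" using G(4) q by simp
    moreover have "((\<lambda>z. z + c) has_derivative (\<lambda>h. h)) (at p)"
      by (auto intro!: derivative_eq_intros)
    ultimately show ?thesis
      unfolding H_def using has_derivative_compose[of "\<lambda>z. z + c" "\<lambda>h. h" p UNIV G L'] by simp
  qed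
  define D where "D = (\<lambda>z. H z - F z)"
  have D: "(D has_derivative (\<lambda>h. L' h - L h)) (at p)"
    unfolding D_def by (rule has_derivative_diff[OF H F(4)])
  have "\<forall>\<^sub>F z in at p. z \<in> W"
    using F(2,3) by (auto simp: local_lift_def eventually_at_topological)
  moreover have "\<forall>\<^sub>F z in at p. z + c \<in> V"
  proof -
    have "isCont (\<lambda>z. z + c) p" by (intro continuous_intros)
    then have "(\<lambda>z. z + c) \<midarrow>p\<rightarrow> p + c" by (simp add: isCont_def)
    then show ?thesis
      using G(2,3) q topological_tendstoD[of "\<lambda>z. z + c" "p + c" "at p" V]
      by (auto simp: local_lift_def)
  qed
  moreover have "\<forall>\<^sub>F z in at p. dist (D z) (D p) < 2 * pi"
  proof -
    have "isCont D p" using D by (rule has_derivative_continuous)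
    then have "D \<midarrow>p\<rightarrow> D p" by (simp add: isCont_def)
    then show ?thesis using tendstoD[of D "D p" "at p" "2 * pi"] by simp
  qed
  ultimately have ev: "\<forall>\<^sub>F z in at p. z \<in> W \<and> z + c \<in> V \<and> dist (D z) (D p) < 2 * pi"
    by eventually_elim simp
  have int: "\<exists>m::int. D z = (2 * pi * of_int m, 0)" if "z \<in> W" "z + c \<in> V" for z
  proof -
    have "cover (F z) = \<psi> (cover z)" using F(3) that by (auto simp: local_lift_def)
    moreover have "cover (H z) = \<psi> (cover z)"
      using G(3) that cc by (auto simp: local_lift_def H_def)
    ultimately have "cover (F z) = cover (H z)" by simp
    then show ?thesis by (auto simp: cover_eq_iff D_def)
  qed
  have "\<forall>\<^sub>F z in at p. D z = D p"
    using ev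
  proof (eventually_elim)
    case (elim z)
    obtain m :: int where m: "D z = (2 * pi * of_int m, 0)" using int elim by blast
    obtain n :: int where n: "D p = (2 * pi * of_int n, 0)" using int[of p] F(2) G(2) q by blast
    have "dist (D z) (D p) = 2 * pi * \<bar>of_int (m - n)\<bar>"
      by (simp add: m n dist_Pair_Pair dist_real_def abs_mult flip: right_diff_distrib)
    then have "\<bar>real_of_int (m - n)\<bar> < 1" using elim by simp
    then have "m = n" by linarith
    then show ?case using m n by simp
  qed
  then have "((\<lambda>z. D p) has_derivative (\<lambda>h. L' h - L h)) (at p)"
    using D has_derivative_transform_eventually[of D "\<lambda>h. L' h - L h" p UNIV "\<lambda>z. D p"] by simp
  then have "(\<lambda>h. L' h - L h) = (\<lambda>h. 0)"
    using has_derivative_unique has_derivative_const by blast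
  then have "L' h - L h = 0" for h by (rule fun_cong)
  then show ?thesis by (intro ext) (metis eq_iff_diff_eq_0)
qed


section \<open>Control-affine systems and their equivalence\<close>

text \<open>The system \<open>x' = f\<^sub>0(x) + \<Sum>\<^sub>j u\<^sub>j f\<^sub>j(x)\<close>, \<open>u \<in> \<Omega>\<close>, the inputs being indexed by the finite type \<open>'m\<close>.\<close>

record ('m::finite) control_affine_system =
  drift :: vector_field
  control_field :: "'m \<Rightarrow> vector_field"
  control_range :: "(real ^ 'm) set"

definition dynamics :: "'m::finite control_affine_system \<Rightarrow> real ^ 'm \<Rightarrow> vector_field" where
  "dynamics S u x = drift S x + (\<Sum>j\<in>UNIV. u $ j *\<^sub>R control_field S j x)"

definition equivalent ::
  "'m::finite control_affine_system \<Rightarrow> 'm control_affine_system \<Rightarrow> bool" where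
  "equivalent S S' \<longleftrightarrow>
     control_range S = control_range S' \<and>
     (\<exists>\<psi>. diffeomorphism \<psi> \<and> related \<psi> (drift S) (drift S') \<and>
          (\<forall>j. related \<psi> (control_field S j) (control_field S' j)))"


section \<open>Rotations and \<open>SE(2)\<close>\<close>

definition theta :: "real ^ 2 ^ 2" where
  "theta = vector [vector [0, -1], vector [1, 0]]"

definition rotation :: "real \<Rightarrow> real ^ 2 ^ 2" where
  "rotation t = vector [vector [cos t, - sin t], vector [sin t, cos t]]"

text \<open>\<open>rotation t\<close> is the matrix exponential of \<open>t \<theta>\<close>.\<close>

lemma rotation_eq_exp:
  "(\<lambda>n. (t ^ n / fact n) *\<^sub>R ((\<lambda>M. theta ** M) ^^ n) (mat 1)) sums rotation t"
proof -
  define P :: "nat \<Rightarrow> real ^ 2 ^ 2" where "P = (\<lambda>n. fact n *\<^sub>R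
    vector [vector [cos_coeff n, - sin_coeff n], vector [sin_coeff n, cos_coeff n]])"
  have P: "((\<lambda>M. theta ** M) ^^ n) (mat 1) = P n" for n
  proof (induction n)
    case 0
    show ?case
      by (simp add: P_def vec_eq_iff forall_2 mat_def cos_coeff_def sin_coeff_def)
  next
    case (Suc n)
    have "theta ** P n = P (Suc n)"
      by (simp add: P_def vec_eq_iff forall_2 theta_def matrix_matrix_mult_def sum_2
          cos_coeff_Suc sin_coeff_Suc del: of_nat_Suc)
    then show ?case using Suc by simp
  qed
  have *: "(t ^ n / fact n) *\<^sub>R P n =
      vector [vector [cos_coeff n *\<^sub>R t ^ n, - (sin_coeff n *\<^sub>R t ^ n)],
              vector [sin_coeff n *\<^sub>R t ^ n, cos_coeff n *\<^sub>R t ^ n]]" for n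
    by (simp add: P_def vec_eq_iff forall_2)
  have "(\<lambda>n. (t ^ n / fact n) *\<^sub>R P n) sums rotation t"
    unfolding sums_def *
  proof (intro vec_tendstoI)
    fix i j :: 2
    show "((\<lambda>N. (\<Sum>n<N. vector [vector [cos_coeff n *\<^sub>R t ^ n, - (sin_coeff n *\<^sub>R t ^ n)],
              vector [sin_coeff n *\<^sub>R t ^ n, cos_coeff n *\<^sub>R t ^ n]] :: real ^ 2 ^ 2) $ i $ j)
            \<longlongrightarrow> rotation t $ i $ j) sequentially"
      using cos_converges[of t, unfolded sums_def] sin_converges[of t, unfolded sums_def]
        sums_minus[OF sin_converges[of t], unfolded sums_def]
      by (cases rule: disjE[OF exhaust_2[of i]]; cases rule: disjE[OF exhaust_2[of j]])
        (simp_all only: rotation_def vector_2 sum_component)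
  qed
  then show ?thesis by (simp add: P)
qed

lift_definition circle_rotation :: "circle \<Rightarrow> real ^ 2 ^ 2" is rotation
proof -
  fix s t assume "angle_eq s t"
  then obtain k :: int where t: "t = s + 2 * pi * of_int k" by (auto simp: angle_eq_def)
  have "cos t = cos s" "sin t = sin s"
    unfolding t cos_add sin_add cos_int_2pin sin_int_2pin by simp_all
  then show "rotation s = rotation t" by (simp add: rotation_def)
qed

lift_definition circle_add :: "circle \<Rightarrow> circle \<Rightarrow> circle" is "(+)"
proof -
  fix s s' t t' assume "angle_eq s s'" "angle_eq t t'"
  then obtain k l :: int where "s' = s + 2 * pi * of_int k" "t' = t + 2 * pi * of_int l"
    by (auto simp: angle_eq_def)
  then have "s' + t' = s + t + 2 * pi * of_int (k + l)"
    by (simp add: algebra_simps)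
  then show "angle_eq (s + t) (s' + t')" unfolding angle_eq_def by blast
qed

definition se2_mult :: "cylinder \<Rightarrow> cylinder \<Rightarrow> cylinder" where
  "se2_mult = (\<lambda>(t1, v1) (t2, v2). (circle_add t1 t2, v1 + circle_rotation t1 *v v2))"

definition left_invariant_field :: "real \<Rightarrow> plane \<Rightarrow> vector_field" where
  "left_invariant_field \<alpha> \<eta>1 = (\<lambda>(t, v). (\<alpha>, circle_rotation t *v \<eta>1))"

lemma Ck_on_const: "Ck_on k (\<lambda>_. c) S"
  by (induction k arbitrary: c) (simp_all add: frechet_derivative_const)

lemma smooth_on_affine:
  assumes "\<And>x. (f has_derivative L) (at x)"
  shows "smooth_on f S"
proof -
  have "frechet_derivative f (at x) = L" for x
    by (rule frechet_derivative_at[OF assms, symmetric])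
  moreover have "continuous_on S f"
    by (intro continuous_at_imp_continuous_on ballI has_derivative_continuous[OF assms])
  moreover have "f differentiable (at x)" for x
    using assms by (auto simp: differentiable_def)
  ultimately have "Ck_on k f S" for k
    by (cases k) (simp_all add: Ck_on_const)
  then show ?thesis by (simp add: smooth_on_def)
qed

lemma left_invariant_field_invariant:
  "related (se2_mult g) (left_invariant_field \<alpha> \<eta>1) (left_invariant_field \<alpha> \<eta>1)"
  unfolding related_def
proof
  fix x :: cylinder
  obtain s w where g: "g = (abs_circle s, w)"
    by (metis abs_circle_surj surj_pair)
  obtain t v where x: "x = (abs_circle t, v)"
    by (metis abs_circle_surj surj_pair)
  define F where "F = (\<lambda>q :: real \<times> plane. (s + fst q, w + rotation s *v snd q))"
  define L where "L = (\<lambda>h :: real \<times> plane. (fst h, rotation s *v snd h))"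
  have D: "(F has_derivative L) (at q)" for q
    unfolding F_def L_def
    by (auto intro!: derivative_eq_intros bounded_linear.has_derivative[OF
        matrix_vector_mul_bounded_linear])
  have "cover (F q) = se2_mult g (cover q)" for q
    by (cases q) (simp add: F_def cover_def g se2_mult_def circle_add.abs_eq
        circle_rotation.abs_eq)
  then have "local_lift (se2_mult g) UNIV F"
    using smooth_on_affine[OF D] by (simp add: local_lift_def)
  moreover have "cover (t, v) = x" by (simp add: x cover_def)
  ultimately have "has_differential (se2_mult g) x L"
    unfolding has_differential_def using D by blast
  moreover have "rotation s ** rotation t = rotation (s + t)"
    by (simp add: vec_eq_iff forall_2 rotation_def matrix_matrix_mult_def sum_2
        cos_add sin_add)
  then have "L (left_invariant_field \<alpha> \<eta>1 x) = left_invariant_field \<alpha> \<eta>1 (se2_mult g x)"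
    by (simp add: L_def left_invariant_field_def g x se2_mult_def circle_add.abs_eq
        circle_rotation.abs_eq matrix_vector_mul_assoc)
  ultimately show "\<exists>L. has_differential (se2_mult g) x L \<and>
      L (left_invariant_field \<alpha> \<eta>1 x) = left_invariant_field \<alpha> \<eta>1 (se2_mult g x)"
    by blast
qed

definition Lambda :: "circle \<Rightarrow> plane \<Rightarrow> plane" where
  "Lambda t \<xi> = (mat 1 - circle_rotation t) *v (theta *v \<xi>)"

text \<open>This is a linear vector field provided that \<open>A\<close> commutes with \<open>theta\<close>.\<close>

definition linear_field :: "plane \<Rightarrow> real ^ 2 ^ 2 \<Rightarrow> vector_field" where
  "linear_field \<xi> A = (\<lambda>(t, v). (0, A *v v + Lambda t \<xi>))"


section \<open>The two systems\<close>

definition linear_control_system ::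
  "plane \<Rightarrow> real ^ 2 ^ 2 \<Rightarrow> real \<Rightarrow> plane \<Rightarrow> (real ^ 1) set \<Rightarrow> 1 control_affine_system" where
  "linear_control_system \<xi> A \<alpha> \<eta>1 \<Omega> =
     \<lparr> drift = linear_field \<xi> A,
       control_field = (\<lambda>_. left_invariant_field \<alpha> \<eta>1),
       control_range = \<Omega> \<rparr>"

definition reduced_system ::
  "real ^ 2 ^ 2 \<Rightarrow> real \<Rightarrow> plane \<Rightarrow> (real ^ 1) set \<Rightarrow> 1 control_affine_system" where
  "reduced_system A \<alpha> \<eta> \<Omega> =
     \<lparr> drift = (\<lambda>(t, v). (0, A *v v)),
       control_field = (\<lambda>_ (t, v). (\<alpha>, - (\<alpha> *\<^sub>R (theta *v v)) + \<eta>)),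
       control_range = \<Omega> \<rparr>"

lemma dynamics_linear_control_system:
  "dynamics (linear_control_system \<xi> A \<alpha> \<eta>1 \<Omega>) u g =
     linear_field \<xi> A g + u $ 1 *\<^sub>R left_invariant_field \<alpha> \<eta>1 g"
  by (simp add: dynamics_def linear_control_system_def UNIV_1)

lemma dynamics_reduced_system:
  "dynamics (reduced_system A \<alpha> \<eta> \<Omega>) u (t, v) =
     (u $ 1 * \<alpha>, (A - (u $ 1 * \<alpha>) *\<^sub>R theta) *v v + u $ 1 *\<^sub>R \<eta>)"
  by (simp add: dynamics_def reduced_system_def UNIV_1 matrix_vector_mult_diff_rdistrib
      scaleR_matrix_vector_assoc[symmetric] algebra_simps)

end

theory Submission
  imports Defs
begin

text \<open>The equivalence is the change to rotating coordinates about a well-chosen centre. As \<open>A\<close> is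
  invertible, there is \<open>p\<close> with \<open>A p = \<theta> \<xi>\<close>, and the drift becomes
  \<open>v' = A (v + p) - \<rho>\<^sub>t \<theta> \<xi>\<close>. Put \<open>w + p = \<rho>\<^sub>-\<^sub>t (v + p)\<close>. Along the drift \<open>t\<close> is constant and \<open>A\<close>
  commutes with rotations, so \<open>w' = A (w + p) - \<theta> \<xi> = A w\<close>. Along the control field \<open>t' = \<alpha>\<close> and
  \<open>v' = \<rho>\<^sub>t \<eta>\<^sub>1\<close>, so \<open>w' = \<eta>\<^sub>1 - \<alpha> \<theta> (w + p)\<close>, which has the required form with
  \<open>\<eta> = \<eta>\<^sub>1 - \<alpha> \<theta> p\<close>.

  On the covering space this change of coordinates and its inverse are
  \<open>(t, v) \<mapsto> (t, \<rho>\<^bsub>st\<^esub> (v + p) - p)\<close> with \<open>s = -1\<close> and \<open>s = 1\<close>. Both are smooth because they belong to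
  a family of maps that is closed under directional derivatives (\<open>Ck_on_rotating_affine\<close>).\<close>

lemma rotation_mult_vec: "rotation t *v x = cos t *\<^sub>R x + sin t *\<^sub>R (theta *v x)"
  by (simp add: vec_eq_iff forall_2 rotation_def theta_def matrix_vector_mult_def sum_2)

lemma theta_theta_mult_vec: "theta *v (theta *v x) = - x"
  by (simp add: vec_eq_iff forall_2 theta_def matrix_vector_mult_def sum_2)

lemma rotation_mult_rotation: "rotation s *v (rotation t *v x) = rotation (s + t) *v x"
  by (simp add: rotation_mult_vec theta_theta_mult_vec cos_add sin_add algebra_simps
      matrix_vector_right_distrib matrix_vector_mult_scaleR)

lemma rotation_zero: "rotation 0 *v x = x"
  by (simp add: rotation_mult_vec)

lemma transpose_rotation: "transpose (rotation t) = rotation (- t)"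
  by (simp add: vec_eq_iff forall_2 rotation_def transpose_def)

lemma commutes_with_rotation:
  assumes "A ** theta = theta ** A"
  shows "A *v (rotation t *v x) = rotation t *v (A *v x)"
proof -
  have "A *v (theta *v x) = theta *v (A *v x)"
    by (simp add: matrix_vector_mul_assoc assms)
  then show ?thesis
    by (simp add: rotation_mult_vec matrix_vector_right_distrib matrix_vector_mult_scaleR)
qed

lemma has_derivative_rotation_mult_vec:
  assumes "(f has_derivative f') (at q)" "(g has_derivative g') (at q)"
  shows "((\<lambda>q. rotation (f q) *v g q) has_derivative
    (\<lambda>h. rotation (f q) *v (g' h + f' h *\<^sub>R (theta *v g q)))) (at q)"
proof -
  have "((\<lambda>q. theta *v g q) has_derivative (\<lambda>h. theta *v g' h)) (at q)"
    by (rule bounded_linear.has_derivative[OF matrix_vector_mul_bounded_linear assms(2)])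
  then show ?thesis
    unfolding rotation_mult_vec
    by (auto intro!: derivative_eq_intros assms
        simp: theta_theta_mult_vec matrix_vector_right_distrib matrix_vector_mult_scaleR
          algebra_simps)
qed


text \<open>The family of all these maps is closed under directional derivatives, so that differentiability
  of its members gives all orders at once. The change of coordinates alone is not closed in this
  way: its derivatives involve other matrices \<open>M\<close> and other constants.\<close>

definition rotating_affine ::
  "real \<Rightarrow> real \<times> real \<Rightarrow> plane \<Rightarrow> real ^ 2 ^ 2 \<Rightarrow> plane \<Rightarrow> real \<times> plane \<Rightarrow> real \<times> plane" where
  "rotating_affine s ab d M c q =
     (fst ab * fst q + snd ab, rotation (s * fst q) *v (M *v snd q + c) + d)"

lemma has_derivative_rotating_affine:
  "(rotating_affine s ab d M c has_derivative
     (\<lambda>h. (fst ab * fst h, rotation (s * fst q) *v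
       (M *v snd h + (s * fst h) *\<^sub>R (theta *v (M *v snd q + c)))))) (at q)"
proof -
  have "((\<lambda>q. M *v snd q + c) has_derivative (\<lambda>h. M *v snd h)) (at q)"
    by (auto intro!: derivative_eq_intros
        bounded_linear.has_derivative[OF matrix_vector_mul_bounded_linear])
  then show ?thesis
    unfolding rotating_affine_def[abs_def]
    by (auto intro!: derivative_eq_intros has_derivative_rotation_mult_vec)
qed

lemma Ck_on_rotating_affine: "Ck_on k (rotating_affine s ab d M c) S"
proof (induction k arbitrary: ab d M c)
  case 0
  show ?case
    by (auto intro!: continuous_at_imp_continuous_on
        has_derivative_continuous[OF has_derivative_rotating_affine])
next
  case (Suc k)
  have "(\<lambda>q. frechet_derivative (rotating_affine s ab d M c) (at q) h) =
      rotating_affine s (0, fst ab * fst h) 0 ((s * fst h) *\<^sub>R (theta ** M))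
        (M *v snd h + (s * fst h) *\<^sub>R (theta *v c))" for h
    by (rule ext)
      (simp add: frechet_derivative_at[OF has_derivative_rotating_affine, symmetric]
        rotating_affine_def matrix_vector_right_distrib matrix_vector_mul_assoc
        scaleR_matrix_vector_assoc[symmetric] algebra_simps)
  moreover have "rotating_affine s ab d M c differentiable (at q)" for q
    unfolding differentiable_def using has_derivative_rotating_affine by blast
  ultimately show ?case
    using Suc by simp
qed


definition lifted_twist :: "plane \<Rightarrow> real \<Rightarrow> real \<times> plane \<Rightarrow> real \<times> plane" where
  "lifted_twist p s q = (fst q, rotation (s * fst q) *v (snd q + p) - p)"

lemma lifted_twist_eq: "lifted_twist p s = rotating_affine s (1, 0) (- p) (mat 1) p"
  by (rule ext) (simp add: lifted_twist_def rotating_affine_def)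

lemma smooth_on_lifted_twist: "smooth_on (lifted_twist p s) S"
  by (simp add: smooth_on_def lifted_twist_eq Ck_on_rotating_affine)

lemma has_derivative_lifted_twist:
  "(lifted_twist p s has_derivative
     (\<lambda>h. (fst h, rotation (s * fst q) *v
       (snd h + (s * fst h) *\<^sub>R (theta *v (snd q + p)))))) (at q)"
  using has_derivative_rotating_affine[of s "(1, 0)" "- p" "mat 1" p q]
  by (simp add: lifted_twist_eq)

definition twist :: "plane \<Rightarrow> cylinder \<Rightarrow> cylinder" where
  "twist p = (\<lambda>(t, v). (t, circle_rotation t *v (v + p) - p))"

text \<open>The transpose is the inverse rotation \<open>\<rho>\<^sub>-\<^sub>t\<close>; in this form it is visibly well defined on the
  circle.\<close>

definition untwist :: "plane \<Rightarrow> cylinder \<Rightarrow> cylinder" where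
  "untwist p = (\<lambda>(t, v). (t, transpose (circle_rotation t) *v (v + p) - p))"

lemma cylinder_cases:
  obtains q where "x = cover q"
proof -
  obtain t v where "x = (abs_circle t, v)"
    by (metis abs_circle_surj surj_pair)
  then have "x = cover (t, v)" by (simp add: cover_def)
  then show thesis by (rule that)
qed

lemma twist_cover: "twist p (cover q) = cover (lifted_twist p 1 q)"
  by (cases q) (simp add: cover_def twist_def lifted_twist_def circle_rotation.abs_eq)

lemma untwist_cover: "untwist p (cover q) = cover (lifted_twist p (- 1) q)"
  by (cases q)
    (simp add: cover_def untwist_def lifted_twist_def circle_rotation.abs_eq transpose_rotation
      del: transpose_matrix_vector)

lemma lifted_twist_inverse: "lifted_twist p s (lifted_twist p (- s) q) = q"
  by (simp add: lifted_twist_def rotation_mult_rotation rotation_zero)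

lemma twist_untwist: "twist p (untwist p x) = x"
  by (cases x rule: cylinder_cases)
    (simp add: twist_cover untwist_cover lifted_twist_inverse)

lemma untwist_twist: "untwist p (twist p x) = x"
  using lifted_twist_inverse[of p "- 1"]
  by (cases x rule: cylinder_cases) (simp add: twist_cover untwist_cover)

lemma local_lift_untwist: "local_lift (untwist p) UNIV (lifted_twist p (- 1))"
  by (simp add: local_lift_def smooth_on_lifted_twist untwist_cover)

lemma diffeomorphism_untwist: "diffeomorphism (untwist p)"
proof -
  have "local_lift (twist p) UNIV (lifted_twist p 1)"
    by (simp add: local_lift_def smooth_on_lifted_twist twist_cover)
  then have "smooth_map (untwist p)" "smooth_map (twist p)"
    using local_lift_untwist unfolding smooth_map_def by blast+
  moreover have "bij (untwist p)"
    by (rule o_bij[of "twist p"]) (auto simp: twist_untwist untwist_twist)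
  moreover have "inv (untwist p) = twist p"
    by (rule inv_unique_comp) (auto simp: twist_untwist untwist_twist)
  ultimately show ?thesis by (simp add: diffeomorphism_def)
qed

text \<open>Relatedness reduces to an identity on the covering space: \<open>\<theta>\<close> commutes with rotations and
  \<open>d\<rho>\<^sub>-\<^sub>t/dt = - \<rho>\<^sub>-\<^sub>t \<theta>\<close>, so the differential sends \<open>(\<tau>, h)\<close> to
  \<open>(\<tau>, \<rho>\<^sub>-\<^sub>t (h - \<tau> \<theta> (v + p)))\<close>.\<close>

lemma related_untwistI:
  assumes "\<And>t v. (fst (f (cover (t, v))), rotation (- t) *v
      (snd (f (cover (t, v))) - fst (f (cover (t, v))) *\<^sub>R (theta *v (v + p)))) =
    g (cover (t, rotation (- t) *v (v + p) - p))"
  shows "related (untwist p) f g"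
  unfolding related_def
proof
  fix x :: cylinder
  obtain t v where x: "x = cover (t, v)"
    by (metis cylinder_cases surj_pair)
  define L where "L = (\<lambda>h :: real \<times> plane.
    (fst h, rotation (- t) *v (snd h - fst h *\<^sub>R (theta *v (v + p)))))"
  have "(lifted_twist p (- 1) has_derivative L) (at (t, v))"
    using has_derivative_lifted_twist[of p "- 1" "(t, v)"] by (simp add: L_def)
  then have "has_differential (untwist p) x L"
    unfolding has_differential_def x using local_lift_untwist by blast
  moreover have "L (f x) = g (untwist p x)"
    using assms[of t v] by (simp add: L_def x untwist_cover lifted_twist_def)
  ultimately show "\<exists>L. has_differential (untwist p) x L \<and> L (f x) = g (untwist p x)"
    by blast
qed

lemma theta_commutes_with_rotation: "theta *v (rotation t *v x) = rotation t *v (theta *v x)"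
  by (rule commutes_with_rotation) simp

text \<open>The term \<open>- \<rho>\<^sub>t \<theta> \<xi>\<close> of the drift becomes constant in the rotating coordinates and cancels
  against \<open>A p\<close>.\<close>

lemma related_untwist_linear_field:
  assumes "A ** theta = theta ** A" and p: "A *v p = theta *v \<xi>"
  shows "related (untwist p) (linear_field \<xi> A) (\<lambda>(t, v). (0, A *v v))"
proof (rule related_untwistI)
  fix t :: real and v :: plane
  have "A *v v + Lambda (abs_circle t) \<xi> = A *v (v + p) - rotation t *v (theta *v \<xi>)"
    by (simp add: Lambda_def circle_rotation.abs_eq p matrix_vector_right_distrib
        matrix_vector_mult_diff_rdistrib)
  then have "rotation (- t) *v (A *v v + Lambda (abs_circle t) \<xi>) =
      rotation (- t) *v (A *v (v + p) - rotation t *v (theta *v \<xi>))"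
    by simp
  also have "\<dots> = A *v (rotation (- t) *v (v + p)) - theta *v \<xi>"
    by (simp add: matrix_vector_mult_diff_distrib rotation_mult_rotation rotation_zero
        commutes_with_rotation[OF assms(1)])
  also have "\<dots> = A *v (rotation (- t) *v (v + p) - p)"
    by (simp add: p matrix_vector_mult_diff_distrib)
  finally show "(fst (linear_field \<xi> A (cover (t, v))), rotation (- t) *v
      (snd (linear_field \<xi> A (cover (t, v))) -
        fst (linear_field \<xi> A (cover (t, v))) *\<^sub>R (theta *v (v + p)))) =
    (case cover (t, rotation (- t) *v (v + p) - p) of (t, v) \<Rightarrow> (0, A *v v))"
    by (simp add: linear_field_def cover_def)
qed

text \<open>The vector \<open>\<rho>\<^sub>t \<eta>\<^sub>1\<close> is constant in the rotating coordinates; their rotation with velocity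
  \<open>-\<alpha>\<close> about \<open>-p\<close> contributes the rest.\<close>

lemma related_untwist_left_invariant_field:
  "related (untwist p) (left_invariant_field \<alpha> \<eta>1)
     (\<lambda>(t, v). (\<alpha>, - (\<alpha> *\<^sub>R (theta *v v)) + (\<eta>1 - \<alpha> *\<^sub>R (theta *v p))))"
  by (rule related_untwistI)
    (simp add: left_invariant_field_def cover_def circle_rotation.abs_eq
      matrix_vector_mult_diff_distrib matrix_vector_mult_scaleR rotation_mult_rotation
      rotation_zero theta_commutes_with_rotation scaleR_diff_right)

theorem proposition2p3:
  fixes A :: "real ^ 2 ^ 2" and \<xi> \<eta>1 :: "real ^ 2" and \<alpha> u_minus u_plus :: real
  assumes "A ** theta = theta ** A"
    and "u_minus < 0" and "0 < u_plus"
    and "\<Omega> = {u :: real ^ 1. u $ 1 \<in> {u_minus..u_plus}}"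
    and "det A \<noteq> 0"
  shows "\<exists>\<eta> :: real ^ 2.
    equivalent (linear_control_system \<xi> A \<alpha> \<eta>1 \<Omega>) (reduced_system A \<alpha> \<eta> \<Omega>)"
proof -
  obtain B where "A ** B = mat 1"
    using assms(5) by (auto simp: invertible_det_nz[symmetric] invertible_def)
  define p where "p = B *v (theta *v \<xi>)"
  have "A *v p = (A ** B) *v (theta *v \<xi>)"
    by (simp add: p_def matrix_vector_mul_assoc matrix_mul_assoc)
  then have "A *v p = theta *v \<xi>"
    by (simp add: \<open>A ** B = mat 1\<close>)
  note related_untwist_linear_field[OF assms(1) this]
  then have "equivalent (linear_control_system \<xi> A \<alpha> \<eta>1 \<Omega>)
      (reduced_system A \<alpha> (\<eta>1 - \<alpha> *\<^sub>R (theta *v p)) \<Omega>)"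
    unfolding equivalent_def linear_control_system_def reduced_system_def
      control_affine_system.simps
    using diffeomorphism_untwist related_untwist_left_invariant_field by blast
  then show ?thesis by blast
qed

end
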